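(* Let $0<a<1$ and let $C_{\vec e_3,a}=\{x\in\mathbb{R}^3:\ \langle x/|x|,\vec e_3\rangle\le a\}$. Let $\varphi:\mathbb{R}\to\mathbb{R}$ be smooth. There is no $\varphi$-stochastically complete $[\varphi,\vec e_3]$-minimal surface $\Sigma$ contained in $C_{\vec e_3,a}$ such that $\dot\varphi(\mu(p))>\xi$ for all $p\in\Sigma$, for some constant $\xi>\frac{2a}{1-a^2}$.
   Context: Surfaces are connected, orientable, immersed in $\mathbb{R}^3$, without boundary, with unit normal $N$; $\{\vec e_1,\vec e_2,\vec e_3\}$ is the standard basis. For a surface $\Sigma$, $\mu(p)=\langle p,\vec e_3\rangle$ is the height function and $\eta=\langle N,\vec e_3\rangle$ the angle function. $\Sigma$ is $[\varphi,\vec e_3]$-minimal if its mean curvature vector $\vec H$ (trace of the second fundamental form) satisfies $\vec H=\dot\varphi(\mu)\,\eta\,N$. On $\Sigma$ write $\varphi$ for $\varphi\circ\mu$ and let $\Delta^{\varphi}u=\Delta u+\langle\nabla\varphi,\nabla u\rangle$ (induced metric). $\Sigma$ is $\varphi$-stochastically complete if for every $u\in C^2(\Sigma)$ with $u^*=\sup_\Sigma u<+\infty$ there is a sequence $p_n\in\Sigma$ with $u(p_n)>u^*-1/n$ and $\Delta^{\varphi}u(p_n)<1/n$ for all $n$. *)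

theory Defs
  imports "HOL-Analysis.Analysis"
begin

definition pd :: "'a::euclidean_space \<Rightarrow> ('a \<Rightarrow> 'b::real_normed_vector) \<Rightarrow> 'a \<Rightarrow> 'b" where
  "pd v f w = frechet_derivative f (at w) v"

fun Ck :: "nat \<Rightarrow> 'a::euclidean_space set \<Rightarrow> ('a \<Rightarrow> 'b::real_normed_vector) \<Rightarrow> bool" where
  "Ck 0 W f = continuous_on W f"
| "Ck (Suc k) W f = (f differentiable_on W \<and> (\<forall>v\<in>Basis. Ck k W (pd v f)))"

definition smooth_on :: "'a::euclidean_space set \<Rightarrow> ('a \<Rightarrow> 'b::real_normed_vector) \<Rightarrow> bool" where
  "smooth_on W f = (\<forall>k. Ck k W f)"

definition e3 :: "real^3" where "e3 = axis 3 1"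

definition bv :: "2 \<Rightarrow> real^2" where "bv i = axis i 1"

definition local_param :: "('m::topological_space \<Rightarrow> real^3) \<Rightarrow> (real^2) set \<Rightarrow> (real^2 \<Rightarrow> 'm) \<Rightarrow> bool" where
  "local_param X W p \<longleftrightarrow> open W \<and> open (p ` W) \<and> homeomorphism W (p ` W) p (inv_into W p)
     \<and> smooth_on W (X \<circ> p)
     \<and> (\<forall>w\<in>W. inj (frechet_derivative (X \<circ> p) (at w)))"

text \<open>Connected immersed surface without boundary (the abstract surface is the space 'm).\<close>
definition immersed_surface :: "('m::t2_space \<Rightarrow> real^3) \<Rightarrow> bool" where
  "immersed_surface X \<longleftrightarrow> connected (UNIV :: 'm set)
     \<and> (\<forall>q. \<exists>W p w. local_param X W p \<and> w \<in> W \<and> p w = q)"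

text \<open>N is a continuous (global) unit normal; its existence is orientability.\<close>
definition unit_normal :: "('m::topological_space \<Rightarrow> real^3) \<Rightarrow> ('m \<Rightarrow> real^3) \<Rightarrow> bool" where
  "unit_normal X N \<longleftrightarrow> continuous_on UNIV N \<and> (\<forall>q. norm (N q) = 1)
     \<and> (\<forall>W p w i. local_param X W p \<and> w \<in> W \<longrightarrow> inner (N (p w)) (pd (bv i) (X \<circ> p) w) = 0)"

definition height :: "('m \<Rightarrow> real^3) \<Rightarrow> 'm \<Rightarrow> real" where
  "height X q = inner (X q) e3"

definition angle_fun :: "('m \<Rightarrow> real^3) \<Rightarrow> 'm \<Rightarrow> real" where
  "angle_fun N q = inner (N q) e3"

definition metric_loc :: "('m \<Rightarrow> real^3) \<Rightarrow> (real^2 \<Rightarrow> 'm) \<Rightarrow> real^2 \<Rightarrow> real^2^2" where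
  "metric_loc X p w = (\<chi> i j. inner (pd (bv i) (X \<circ> p) w) (pd (bv j) (X \<circ> p) w))"

definition metric_inv_loc :: "('m \<Rightarrow> real^3) \<Rightarrow> (real^2 \<Rightarrow> 'm) \<Rightarrow> real^2 \<Rightarrow> 2 \<Rightarrow> 2 \<Rightarrow> real" where
  "metric_inv_loc X p w i j = matrix_inv (metric_loc X p w) $ i $ j"

text \<open>Mean curvature vector (trace of the second fundamental form) at p w.\<close>
definition mean_curv_vec_loc :: "('m \<Rightarrow> real^3) \<Rightarrow> ('m \<Rightarrow> real^3) \<Rightarrow> (real^2 \<Rightarrow> 'm) \<Rightarrow> real^2 \<Rightarrow> real^3" where
  "mean_curv_vec_loc X N p w =
     (\<Sum>i\<in>UNIV. \<Sum>j\<in>UNIV. metric_inv_loc X p w i j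
        * inner (pd (bv i) (pd (bv j) (X \<circ> p)) w) (N (p w))) *\<^sub>R N (p w)"

definition phi_minimal :: "('m::topological_space \<Rightarrow> real^3) \<Rightarrow> ('m \<Rightarrow> real^3) \<Rightarrow> (real \<Rightarrow> real) \<Rightarrow> bool" where
  "phi_minimal X N \<phi> \<longleftrightarrow> (\<forall>W p w. local_param X W p \<and> w \<in> W \<longrightarrow>
     mean_curv_vec_loc X N p w = (deriv \<phi> (height X (p w)) * angle_fun N (p w)) *\<^sub>R N (p w))"

text \<open>The drift Laplacian \<Delta>^\<phi> u = \<Delta> u + <\<nabla>(\<phi>\<circ>\<mu>), \<nabla>u> computed in local coordinates
  (Laplace--Beltrami operator in divergence form).\<close>
definition lap_phi_loc :: "('m \<Rightarrow> real^3) \<Rightarrow> (real \<Rightarrow> real) \<Rightarrow> ('m \<Rightarrow> real) \<Rightarrow> (real^2 \<Rightarrow> 'm) \<Rightarrow> real^2 \<Rightarrow> real" where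
  "lap_phi_loc X \<phi> u p w =
     (let sg = (\<lambda>z. sqrt (det (metric_loc X p z)));
          v = u \<circ> p;
          f = (\<lambda>z. \<phi> (height X (p z)))
      in (1 / sg w) * (\<Sum>i\<in>UNIV. pd (bv i)
             (\<lambda>z. sg z * (\<Sum>j\<in>UNIV. metric_inv_loc X p z i j * pd (bv j) v z)) w)
         + (\<Sum>i\<in>UNIV. \<Sum>j\<in>UNIV. metric_inv_loc X p w i j * pd (bv i) f w * pd (bv j) v w))"

definition C2_surf :: "('m::topological_space \<Rightarrow> real^3) \<Rightarrow> ('m \<Rightarrow> real) \<Rightarrow> bool" where
  "C2_surf X u \<longleftrightarrow> (\<forall>W p. local_param X W p \<longrightarrow> Ck 2 W (u \<circ> p))"

text \<open>\<phi>-stochastic completeness (Omori--Yau type weak maximum principle for \<Delta>^\<phi>).\<close>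
definition phi_stoch_complete :: "('m::topological_space \<Rightarrow> real^3) \<Rightarrow> (real \<Rightarrow> real) \<Rightarrow> bool" where
  "phi_stoch_complete X \<phi> \<longleftrightarrow> (\<forall>u. C2_surf X u \<and> bdd_above (range u) \<longrightarrow>
     (\<exists>q :: nat \<Rightarrow> 'm. \<forall>n::nat. n > 0 \<longrightarrow>
        u (q n) > (SUP x. u x) - 1 / real n
        \<and> (\<exists>W p w. local_param X W p \<and> w \<in> W \<and> p w = q n
               \<and> lap_phi_loc X \<phi> u p w < 1 / real n)))"

definition cone_set :: "real \<Rightarrow> (real^3) set" where
  "cone_set a = {x. inner (x /\<^sub>R norm x) e3 \<le> a}"

end

theory Submission
  imports Defs
begin

text \<open>The function \<open>u = \<mu> - a * sqrt (1 + |X|\<^sup>2)\<close> is smooth and nonpositive on a surface inside the cone.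
  On a \<open>\<phi>\<close>-minimal surface the drift Laplacian of the position vector is \<open>\<phi>' e3\<close>, so for the ambient
  gradient \<open>U\<close> of \<open>u\<close> the drift Laplacian of \<open>u\<close> is \<open>\<phi>' \<langle>e3, U\<rangle>\<close> plus the tangential trace of the
  Hessian. The first term is at least \<open>\<xi> (1 - a\<^sup>2)\<close> since \<open>\<mu> \<le> a * sqrt (1 + |X|\<^sup>2)\<close>, the second at
  least \<open>- 2 a\<close>. So the drift Laplacian of the bounded-above function \<open>u\<close> exceeds a positive constant
  everywhere, contradicting stochastic completeness.\<close>

section \<open>Directional derivatives and symmetry of mixed second derivatives\<close>

lemma pd_eqI: "(f has_derivative f') (at w) \<Longrightarrow> pd v f w = f' v"
  by (simp add: pd_def frechet_derivative_at[symmetric])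

text \<open>No differentiability is assumed: both functions admit the same candidate derivatives at
  \<open>w\<close>, so the choice inside \<open>frechet_derivative\<close> returns the same value
  for both.\<close>

lemma pd_cong_open:
  assumes "open W" "w \<in> W" "\<And>z. z \<in> W \<Longrightarrow> f z = g z"
  shows "pd v f w = pd v g w"
proof -
  have "(f has_derivative D) (at w) \<longleftrightarrow> (g has_derivative D) (at w)" for D
    using assms has_derivative_transform_within_open[of f D w UNIV W g]
      has_derivative_transform_within_open[of g D w UNIV W f] by auto
  then show ?thesis by (simp add: pd_def frechet_derivative_def)
qed

text \<open>The double difference is an increment in direction \<open>a\<close> of a difference in
  direction \<open>b\<close>. The mean value theorem turns it into \<open>t\<close> times a
  difference of values of \<open>pd a f\<close>, and the first-order expansion of
  \<open>pd a f\<close> at \<open>w\<close> turns that difference into \<open>t * L b\<close> with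
  an error small relative to \<open>t\<close>.\<close>

lemma second_difference_quotient:
  fixes f :: "'a::euclidean_space \<Rightarrow> real"
  assumes W: "open W" "w \<in> W" and f: "f differentiable_on W"
    and g: "(pd a f has_derivative L) (at w)" and e: "e > 0"
  shows "\<exists>d>0. \<forall>t. 0 < t \<and> t < d \<longrightarrow>
    \<bar>f (w + t *\<^sub>R a + t *\<^sub>R b) - f (w + t *\<^sub>R a) - f (w + t *\<^sub>R b) + f w - t^2 * L b\<bar> \<le> e * t^2"
proof -
  interpret L: linear L using g has_derivative_linear by blast
  \<comment> \<open>\<open>t * (K / 2)\<close> bounds the distance from \<open>w\<close> to every
    point reached with coefficients of \<open>a\<close> and \<open>b\<close> between 0 and
    \<open>t\<close>. The summand 1 keeps \<open>K\<close> positive when both vectors vanish; the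
    factor 2 leaves an error of \<open>e * t / 2\<close> at each of the two points compared
    below.\<close>
  define K where "K = 2 * (norm a + norm b + 1)"
  have K: "K > 0" by (simp add: K_def add_nonneg_pos)
  obtain d1 where d1: "d1 > 0" "\<And>y. norm (y - w) < d1 \<Longrightarrow>
      norm (pd a f y - pd a f w - L (y - w)) \<le> e / K * norm (y - w)"
  proof -
    have "e / K > 0" using e K by simp
    then show ?thesis using g that unfolding has_derivative_at_alt by blast
  qed
  obtain d2 where d2: "d2 > 0" "ball w d2 \<subseteq> W" using W openE by blast
  define d where "d = min d1 d2 / K"
  have d: "d > 0" using d1 d2 K by (simp add: d_def)
  have main: "\<bar>f (w + t *\<^sub>R a + t *\<^sub>R b) - f (w + t *\<^sub>R a) - f (w + t *\<^sub>R b) + f w - t^2 * L b\<bar> \<le> e * t^2"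
    if t: "0 < t" "t < d" for t
  proof -
    have tK: "t * K < min d1 d2" using t K by (simp add: d_def field_simps)
    have nrm: "norm (s *\<^sub>R a + r *\<^sub>R b) \<le> t * (K / 2)" if "0 \<le> s" "s \<le> t" "0 \<le> r" "r \<le> t" for s r
    proof -
      have "norm (s *\<^sub>R a + r *\<^sub>R b) \<le> s * norm a + r * norm b"
        using that norm_triangle_ineq[of "s *\<^sub>R a" "r *\<^sub>R b"] by simp
      also have "\<dots> \<le> t * norm a + t * norm b"
        using that by (intro add_mono mult_right_mono) auto
      also have "\<dots> \<le> t * (K / 2)" using t by (simp add: K_def algebra_simps)
      finally show ?thesis .
    qed
    have tK2: "t * (K / 2) < d1" "t * (K / 2) < d2"
      using tK t d1(1) d2(1) K mult_pos_pos[of t K] by (simp_all; linarith)+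
    have inW: "w + s *\<^sub>R a + r *\<^sub>R b \<in> W" if "0 \<le> s" "s \<le> t" "0 \<le> r" "r \<le> t" for s r
    proof -
      have "dist w (w + s *\<^sub>R a + r *\<^sub>R b) = norm (s *\<^sub>R a + r *\<^sub>R b)"
        unfolding dist_commute[of w] by (simp add: dist_norm add.assoc)
      then show ?thesis using nrm[OF that] tK2 d2(2) by (auto simp: subset_iff)
    qed
    \<comment> \<open>The double difference is \<open>h t - h 0\<close>.\<close>
    define h where "h s = f (w + s *\<^sub>R a + t *\<^sub>R b) - f (w + s *\<^sub>R a)" for s
    have fd: "((\<lambda>s. f (w + s *\<^sub>R a + r *\<^sub>R b)) has_real_derivative pd a f (w + s *\<^sub>R a + r *\<^sub>R b)) (at s)"
      if "0 \<le> s" "s \<le> t" "0 \<le> r" "r \<le> t" for s r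
    proof -
      have "f differentiable (at (w + s *\<^sub>R a + r *\<^sub>R b))"
        using f inW[OF that] W(1) by (simp add: differentiable_on_eq_differentiable_at)
      then have D: "(f has_derivative frechet_derivative f (at (w + s *\<^sub>R a + r *\<^sub>R b))) (at (w + s *\<^sub>R a + r *\<^sub>R b))"
        by (simp add: frechet_derivative_works)
      have "((\<lambda>s. f (w + s *\<^sub>R a + r *\<^sub>R b)) has_derivative
          (\<lambda>h. frechet_derivative f (at (w + s *\<^sub>R a + r *\<^sub>R b)) (h *\<^sub>R a))) (at s)"
        by (rule has_derivative_compose[where f = "\<lambda>s. w + s *\<^sub>R a + r *\<^sub>R b", OF _ D])
          (auto intro!: derivative_eq_intros)
      then show ?thesis
        unfolding has_field_derivative_def pd_def
        using linear_cmul[OF has_derivative_linear[OF D]] by (simp add: mult.commute[of _ "frechet_derivative _ _ _"])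
    qed
    have "\<exists>s. 0 < s \<and> s < t \<and> h t - h 0 = (t - 0) * (pd a f (w + s *\<^sub>R a + t *\<^sub>R b) - pd a f (w + s *\<^sub>R a))"
      unfolding h_def
      apply (rule MVT2[OF t(1)])
      subgoal for s using fd[of s t] fd[of s 0] t(1) by (auto intro: DERIV_diff)
      done
    then obtain s where s: "0 < s" "s < t"
      and hs: "h t - h 0 = t * (pd a f (w + s *\<^sub>R a + t *\<^sub>R b) - pd a f (w + s *\<^sub>R a))" by auto
    have b1: "\<bar>pd a f (w + s *\<^sub>R a + r *\<^sub>R b) - pd a f w - L (s *\<^sub>R a + r *\<^sub>R b)\<bar> \<le> e * t / 2"
      if "0 \<le> r" "r \<le> t" for r
    proof -
      have n: "norm (s *\<^sub>R a + r *\<^sub>R b) \<le> t * (K / 2)" using nrm s that by simp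
      then have "\<bar>pd a f (w + s *\<^sub>R a + r *\<^sub>R b) - pd a f w - L (s *\<^sub>R a + r *\<^sub>R b)\<bar>
           \<le> e / K * norm (s *\<^sub>R a + r *\<^sub>R b)"
        using d1(2)[of "w + s *\<^sub>R a + r *\<^sub>R b"] tK2 by (simp add: add.assoc)
      also have "\<dots> \<le> e / K * (t * (K / 2))" using n e K by (intro mult_left_mono) auto
      also have "\<dots> = e * t / 2" using K by simp
      finally show ?thesis .
    qed
    \<comment> \<open>Subtracting the estimates for \<open>r = t\<close> and \<open>r = 0\<close>
      cancels \<open>L (s *\<^sub>R a)\<close>, and with it the dependence on the unknown mean value
      point \<open>s\<close>.\<close>
    have "\<bar>(pd a f (w + s *\<^sub>R a + t *\<^sub>R b) - pd a f (w + s *\<^sub>R a)) - t * L b\<bar> \<le> e * t"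
    proof -
      have "\<bar>x - z - (p + q)\<bar> \<le> c / 2 \<Longrightarrow> \<bar>y - z - p\<bar> \<le> c / 2 \<Longrightarrow> \<bar>x - y - q\<bar> \<le> c"
        for x y z p q c :: real by linarith
      from this[of _ "pd a f w" "L (s *\<^sub>R a)" "t * L b" "e * t"] show ?thesis
        using b1[of t] b1[of 0] t(1) by (simp add: L.add L.scale)
    qed
    then have "t * \<bar>(pd a f (w + s *\<^sub>R a + t *\<^sub>R b) - pd a f (w + s *\<^sub>R a)) - t * L b\<bar> \<le> t * (e * t)"
      using t(1) by (intro mult_left_mono) auto
    moreover have "h t - h 0 - t^2 * L b
       = t * ((pd a f (w + s *\<^sub>R a + t *\<^sub>R b) - pd a f (w + s *\<^sub>R a)) - t * L b)"
      by (simp add: hs power2_eq_square algebra_simps)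
    ultimately have "\<bar>h t - h 0 - t^2 * L b\<bar> \<le> e * t^2"
    proof -
      have "\<bar>h t - h 0 - t^2 * L b\<bar>
          = t * \<bar>(pd a f (w + s *\<^sub>R a + t *\<^sub>R b) - pd a f (w + s *\<^sub>R a)) - t * L b\<bar>"
        unfolding \<open>h t - h 0 - t^2 * L b = _\<close> abs_mult using t(1) by simp
      also have "\<dots> \<le> t * (e * t)" by fact
      also have "\<dots> = e * t^2" by (simp add: power2_eq_square)
      finally show ?thesis .
    qed
    then show ?thesis by (simp add: h_def algebra_simps)
  qed
  then show ?thesis using d by blast
qed

text \<open>The double difference is symmetric in \<open>a\<close> and \<open>b\<close>, so
  \<open>t^2 * L b\<close> and \<open>t^2 * M a\<close> both approximate it up to an arbitrarily
  small multiple of \<open>t^2\<close>; dividing by \<open>t^2\<close> identifies them.\<close>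

lemma pd_pd_commute_real:
  fixes f :: "'a::euclidean_space \<Rightarrow> real"
  assumes W: "open W" "w \<in> W" and f: "f differentiable_on W"
    and a: "pd a f differentiable (at w)" and b: "pd b f differentiable (at w)"
  shows "pd b (pd a f) w = pd a (pd b f) w"
proof -
  obtain L where L: "(pd a f has_derivative L) (at w)" using a differentiable_def by blast
  obtain M where M: "(pd b f has_derivative M) (at w)" using b differentiable_def by blast
  have "\<bar>L b - M a\<bar> \<le> e" if e: "e > 0" for e
  proof -
    have e2: "e / 2 > 0" using e by simp
    obtain d1 where d1: "d1 > 0" "\<And>t. 0 < t \<and> t < d1 \<Longrightarrow>
      \<bar>f (w + t *\<^sub>R a + t *\<^sub>R b) - f (w + t *\<^sub>R a) - f (w + t *\<^sub>R b) + f w - t^2 * L b\<bar> \<le> e / 2 * t^2"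
      using second_difference_quotient[OF W f L e2, of b] by blast
    obtain d2 where d2: "d2 > 0" "\<And>t. 0 < t \<and> t < d2 \<Longrightarrow>
      \<bar>f (w + t *\<^sub>R b + t *\<^sub>R a) - f (w + t *\<^sub>R b) - f (w + t *\<^sub>R a) + f w - t^2 * M a\<bar> \<le> e / 2 * t^2"
      using second_difference_quotient[OF W f M e2, of a] by blast
    define t where "t = min d1 d2 / 2"
    have t: "0 < t" "t < d1" "t < d2" using d1 d2 by (auto simp: t_def)
    have "\<bar>t^2 * L b - t^2 * M a\<bar> \<le> e * t^2"
    proof -
      have "\<bar>D - x\<bar> \<le> c \<Longrightarrow> \<bar>D' - y\<bar> \<le> c \<Longrightarrow> D' = D \<Longrightarrow> \<bar>x - y\<bar> \<le> 2 * c" for D D' x y c :: real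
        by linarith
      note abs3 = this[OF d1(2)[OF conjI[OF t(1,2)]] d2(2)[OF conjI[OF t(1,3)]]]
      have "f (w + t *\<^sub>R b + t *\<^sub>R a) - f (w + t *\<^sub>R b) - f (w + t *\<^sub>R a) + f w
         = f (w + t *\<^sub>R a + t *\<^sub>R b) - f (w + t *\<^sub>R a) - f (w + t *\<^sub>R b) + f w"
        by (simp add: add.assoc add.commute[of "t *\<^sub>R b"])
      from abs3[OF this] show ?thesis by simp
    qed
    moreover have "\<bar>t^2 * L b - t^2 * M a\<bar> = t^2 * \<bar>L b - M a\<bar>"
      unfolding right_diff_distrib[symmetric] abs_mult by simp
    ultimately have "t^2 * \<bar>L b - M a\<bar> \<le> t^2 * e" by (simp add: mult.commute)
    then show ?thesis using t by simp
  qed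
  then have "\<bar>L b - M a\<bar> \<le> 0" by (rule field_le_epsilon) simp
  then show ?thesis using pd_eqI[OF L] pd_eqI[OF M] by simp
qed

lemma pd_inner_left:
  assumes "f differentiable (at w)"
  shows "pd v (\<lambda>z. inner (f z) c) w = inner (pd v f w) c"
proof -
  have "(f has_derivative frechet_derivative f (at w)) (at w)"
    using assms by (simp add: frechet_derivative_works)
  then have "((\<lambda>z. inner (f z) c) has_derivative (\<lambda>h. inner (frechet_derivative f (at w) h) c)) (at w)"
    by (auto intro!: derivative_eq_intros)
  then show ?thesis by (subst pd_eqI) (auto simp: pd_def)
qed

text \<open>Testing against each basis vector \<open>c\<close> reduces this to the real-valued case,
  since the inner product with a constant commutes with \<open>pd\<close> at points of
  differentiability.\<close>

lemma pd_pd_commute: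
  fixes f :: "'a::euclidean_space \<Rightarrow> 'b::euclidean_space"
  assumes W: "open W" "w \<in> W" and f: "f differentiable_on W"
    and a: "pd a f differentiable_on W" and b: "pd b f differentiable_on W"
  shows "pd b (pd a f) w = pd a (pd b f) w"
proof (rule euclidean_eqI)
  fix c :: 'b
  have at: "f differentiable (at z)" "pd a f differentiable (at z)" "pd b f differentiable (at z)"
    if "z \<in> W" for z
    using f a b W that by (auto simp: differentiable_on_eq_differentiable_at)
  have eq: "pd v (\<lambda>z. inner (f z) c) z = inner (pd v f z) c" if "z \<in> W" for v z
    by (rule pd_inner_left[OF at(1)[OF that]])
  have dif: "pd v (\<lambda>z. inner (f z) c) differentiable (at w)" if pv: "pd v f differentiable (at w)" for v
  proof -
    obtain D where "(pd v f has_derivative D) (at w)"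
      using pv unfolding differentiable_def by blast
    then have "((\<lambda>z. inner (pd v f z) c) has_derivative (\<lambda>h. inner (D h) c)) (at w)"
      by (rule has_derivative_inner_left)
    then have "(pd v (\<lambda>z. inner (f z) c) has_derivative (\<lambda>h. inner (D h) c)) (at w)"
      by (rule has_derivative_transform_within_open[OF _ W]) (simp add: eq)
    then show ?thesis unfolding differentiable_def by blast
  qed
  have "pd b (pd a (\<lambda>z. inner (f z) c)) w = pd a (pd b (\<lambda>z. inner (f z) c)) w"
  proof (rule pd_pd_commute_real[OF W _ dif dif])
    show "(\<lambda>z. inner (f z) c) differentiable_on W"
      using f unfolding differentiable_on_def by auto
  qed (use at W in auto)
  moreover have "pd u (pd v (\<lambda>z. inner (f z) c)) w = inner (pd u (pd v f) w) c"
    if "pd v f differentiable (at w)" for u v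
  proof -
    have "pd u (pd v (\<lambda>z. inner (f z) c)) w = pd u (\<lambda>z. inner (pd v f z) c) w"
      by (rule pd_cong_open[OF W eq])
    then show ?thesis using pd_inner_left[OF that] by simp
  qed
  ultimately show "inner (pd b (pd a f) w) c = inner (pd a (pd b f) w) c" using at W by simp
qed


section \<open>Inverse metrics, tangent frames, and derivatives of the flux fields\<close>

lemma matrix_inv_2:
  fixes A :: "real^2^2"
  assumes d: "det A \<noteq> 0"
  shows "matrix_inv A $ 1 $ 1 = A $ 2 $ 2 / det A"
    and "matrix_inv A $ 1 $ 2 = - A $ 1 $ 2 / det A"
    and "matrix_inv A $ 2 $ 1 = - A $ 2 $ 1 / det A"
    and "matrix_inv A $ 2 $ 2 = A $ 1 $ 1 / det A"
proof -
  define B :: "real^2^2" where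
    "B = vector [vector [A $ 2 $ 2 / det A, - A $ 1 $ 2 / det A],
                 vector [- A $ 2 $ 1 / det A, A $ 1 $ 1 / det A]]"
  \<comment> \<open>Naming the determinant keeps it opaque to the simplifier; its expansion enters
    only as a rewrite of the diagonal product.\<close>
  define e where "e = det A"
  have e: "e \<noteq> 0" "A $ 1 $ 1 * A $ 2 $ 2 = e + A $ 1 $ 2 * A $ 2 $ 1"
    using d by (simp_all add: e_def det_2)
  have AB: "A ** B = mat 1"
    unfolding B_def e_def[symmetric] using e
    by (simp add: vec_eq_iff forall_2 matrix_matrix_mult_def sum_2 mat_def vector_2)
      (simp add: field_simps)
  then have "B ** A = mat 1" by (simp add: matrix_left_right_inverse)
  then have "matrix_inv A = B"
    unfolding matrix_inv_def using AB
    by (intro some_equality) (auto, metis matrix_mul_assoc matrix_mul_lid matrix_mul_rid)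
  then show "matrix_inv A $ 1 $ 1 = A $ 2 $ 2 / det A"
    and "matrix_inv A $ 1 $ 2 = - A $ 1 $ 2 / det A"
    and "matrix_inv A $ 2 $ 1 = - A $ 2 $ 1 / det A"
    and "matrix_inv A $ 2 $ 2 = A $ 1 $ 1 / det A"
    by (simp_all add: B_def vector_2)
qed

text \<open>The Gram determinant. For a coordinate frame it is the determinant of the induced
  metric, so its square root is the area density.\<close>

definition gram2 :: "'a::real_inner \<Rightarrow> 'a \<Rightarrow> real" where
  "gram2 A B = inner A A * inner B B - (inner A B)\<^sup>2"

lemma gram2_nonneg: "gram2 A B \<ge> 0"
  using Cauchy_Schwarz_ineq[of A B] by (simp add: gram2_def)

lemma gram2_commute: "gram2 A B = gram2 B A"
  by (simp add: gram2_def inner_commute mult.commute)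

text \<open>This is the equality case of Cauchy-Schwarz: the vector
  \<open>inner B B *\<^sub>R A - inner A B *\<^sub>R B\<close> has squared norm
  \<open>inner B B * gram2 A B\<close>, so a zero Gram determinant yields a linear relation between
  \<open>A\<close> and \<open>B\<close>.\<close>

lemma gram2_pos:
  assumes "\<And>x y. x *\<^sub>R A + y *\<^sub>R B = 0 \<Longrightarrow> x = 0 \<and> y = 0"
  shows "gram2 A B > 0"
proof (rule ccontr)
  assume "\<not> gram2 A B > 0"
  then have "gram2 A B = 0" using gram2_nonneg[of A B] by simp
  moreover have "inner (inner B B *\<^sub>R A + (- inner A B) *\<^sub>R B) (inner B B *\<^sub>R A + (- inner A B) *\<^sub>R B)
     = inner B B * gram2 A B"
    by (simp add: gram2_def inner_add_left inner_add_right inner_diff_left inner_diff_right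
        inner_commute[of B A] algebra_simps power2_eq_square)
  ultimately have "inner B B *\<^sub>R A + (- inner A B) *\<^sub>R B = 0" by simp
  then have "inner B B = 0" using assms by blast
  then have "0 *\<^sub>R A + 1 *\<^sub>R B = 0" by simp
  then show False using assms by fastforce
qed

text \<open>If \<open>x\<close> were nonzero, every vector orthogonal to both \<open>n\<close> and
  \<open>x\<close> would be a multiple of their cross product. Then \<open>A\<close> and
  \<open>B\<close> would be parallel and their Gram determinant zero.\<close>

lemma orthogonal_frame_eq_0:
  fixes A B n x :: "real^3"
  assumes D: "gram2 A B > 0" and n: "norm n = 1" "inner n A = 0" "inner n B = 0"
    and x: "inner x n = 0" "inner x A = 0" "inner x B = 0"
  shows "x = 0"
proof (rule ccontr)
  assume nz: "x \<noteq> 0"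
  define c where "c = cross3 n x"
  have "(norm c)\<^sup>2 = (norm x)\<^sup>2"
    using norm_cross[of n x] n(1) x(1) by (simp add: c_def inner_commute)
  then have c: "c \<noteq> 0" using nz by auto
  have orth: "\<exists>t. y = t *\<^sub>R c" if "inner n y = 0" "inner x y = 0" for y
  proof -
    have "cross3 y c = 0" using that unfolding c_def Lagrange by (simp add: inner_commute)
    then have "collinear {0, c, y}" using cross_eq_0[of y c] by (simp add: insert_commute)
    then show ?thesis using c collinear_lemma[of c y] by (metis scaleR_zero_left)
  qed
  obtain s where "A = s *\<^sub>R c" using orth n x by blast
  moreover obtain t where "B = t *\<^sub>R c" using orth n x by blast
  ultimately have "gram2 A B = 0" by (simp add: gram2_def power2_eq_square)
  then show False using D by simp
qed

text \<open>The product splits into its normal part and the product of the tangential projections;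
  the latter is the inverse metric applied to the components along \<open>A\<close> and
  \<open>B\<close>. In the proof, \<open>p\<close> and \<open>q\<close> are the tangential
  coefficients of \<open>x\<close> found by Cramer's rule.\<close>

lemma inner_frame_decomposition:
  fixes A B n x y :: "real^3"
  assumes D: "gram2 A B > 0" and n: "norm n = 1" "inner n A = 0" "inner n B = 0"
  shows "inner x y = inner x n * inner y n
    + (inner B B * (inner x A * inner y A) - inner A B * (inner x A * inner y B + inner x B * inner y A)
       + inner A A * (inner x B * inner y B)) / gram2 A B"
proof -
  define g where "g = gram2 A B"
  define p where "p = (inner B B * inner x A - inner A B * inner x B) / g"
  define q where "q = (inner A A * inner x B - inner A B * inner x A) / g"
  have g: "g \<noteq> 0" "inner A A * inner B B - inner A B * inner A B = g"
    using D by (auto simp: g_def gram2_def power2_eq_square)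
  have nn: "inner n n = 1" using n(1) by (simp add: dot_square_norm)
  have "p * inner A A + q * inner A B = inner x A * (inner A A * inner B B - inner A B * inner A B) / g"
    unfolding p_def q_def by (simp add: add_divide_distrib[symmetric] algebra_simps)
  then have pA: "p * inner A A + q * inner A B = inner x A" using g by simp
  have "p * inner A B + q * inner B B = inner x B * (inner A A * inner B B - inner A B * inner A B) / g"
    unfolding p_def q_def by (simp add: add_divide_distrib[symmetric] algebra_simps)
  then have pB: "p * inner A B + q * inner B B = inner x B" using g by simp
  have "x - (inner x n *\<^sub>R n + p *\<^sub>R A + q *\<^sub>R B) = 0"
    using n pA pB nn
    by (intro orthogonal_frame_eq_0[OF D n])
      (simp_all add: inner_diff_left inner_add_left inner_commute[of A n] inner_commute[of B n]
        inner_commute[of B A])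
  then have "x = inner x n *\<^sub>R n + p *\<^sub>R A + q *\<^sub>R B" by simp
  then have "inner x y = inner (inner x n *\<^sub>R n + p *\<^sub>R A + q *\<^sub>R B) y" by simp
  also have "\<dots> = inner x n * inner y n + (p * inner y A + q * inner y B)"
    by (simp only: inner_add_left inner_scaleR_left inner_commute[of n y] inner_commute[of A y]
        inner_commute[of B y] add.assoc)
  also have "p * inner y A + q * inner y B
    = (inner B B * (inner x A * inner y A) - inner A B * (inner x A * inner y B + inner x B * inner y A)
       + inner A A * (inner x B * inner y B)) / g"
    unfolding p_def q_def by (simp add: add_divide_distrib[symmetric] algebra_simps)
  finally show ?thesis by (simp add: g_def)
qed

text \<open>For a tangent frame \<open>A = Y\<^sub>1\<close>, \<open>B = Y\<^sub>2\<close> this is the field \<open>sqrt (det g) * (\<Sum>j. g\<^sup>1\<^sup>j Y\<^sub>j)\<close> whose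
  first-coordinate derivative enters the Laplacian in divergence form; the second row of the
  inverse metric is \<open>coflux B A\<close>.\<close>
definition coflux :: "'a::real_inner \<Rightarrow> 'a \<Rightarrow> 'a" where
  "coflux A B = (1 / sqrt (gram2 A B)) *\<^sub>R (inner B B *\<^sub>R A - inner A B *\<^sub>R B)"

text \<open>The product rule for \<open>coflux\<close> when the frame moves with velocities
  \<open>A'\<close> and \<open>B'\<close>. The numerator of the last fraction is half the derivative
  of the Gram determinant, as left by differentiating the reciprocal square root.\<close>

definition coflux_deriv :: "'a::real_inner \<Rightarrow> 'a \<Rightarrow> 'a \<Rightarrow> 'a \<Rightarrow> 'a" where
  "coflux_deriv A B A' B' =
     (1 / sqrt (gram2 A B)) *\<^sub>R ((2 * inner B B') *\<^sub>R A + inner B B *\<^sub>R A'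
        - (inner A B' + inner A' B) *\<^sub>R B - inner A B *\<^sub>R B')
     - ((inner A A' * inner B B + inner A A * inner B B' - inner A B * (inner A B' + inner A' B))
        / (gram2 A B * sqrt (gram2 A B))) *\<^sub>R (inner B B *\<^sub>R A - inner A B *\<^sub>R B)"

lemma has_derivative_coflux:
  assumes A: "(A has_derivative A') (at w)" and B: "(B has_derivative B') (at w)"
    and D: "gram2 (A w) (B w) > 0"
  shows "((\<lambda>z. coflux (A z) (B z)) has_derivative
     (\<lambda>h. coflux_deriv (A w) (B w) (A' h) (B' h))) (at w)"
proof -
  define g where "g = gram2 (A w) (B w)"
  define s where "s = sqrt g"
  define k where "k h = inner (A w) (A' h) * inner (B w) (B w) + inner (A w) (A w) * inner (B w) (B' h)
        - inner (A w) (B w) * (inner (A w) (B' h) + inner (A' h) (B w))" for h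
  have s: "s > 0" "s * s = g" using D by (auto simp: s_def g_def)
  have dg: "((\<lambda>z. gram2 (A z) (B z)) has_derivative
     (\<lambda>h. 2 * k h)) (at w)"
    unfolding gram2_def power2_eq_square
    by (rule derivative_eq_intros A B refl)+ (simp add: k_def algebra_simps inner_commute)
  have ds: "((\<lambda>z. 1 / sqrt (gram2 (A z) (B z))) has_derivative
     (\<lambda>h. - (k h / (g * s)))) (at w)"
    by (rule has_derivative_eq_rhs[OF has_derivative_divide[OF has_derivative_const
          has_derivative_real_sqrt[OF D dg]]])
      (use D s in \<open>simp_all add: g_def[symmetric] s_def[symmetric] field_simps\<close>)
  have dv: "((\<lambda>z. inner (B z) (B z) *\<^sub>R A z - inner (A z) (B z) *\<^sub>R B z) has_derivative
     (\<lambda>h. (2 * inner (B w) (B' h)) *\<^sub>R A w + inner (B w) (B w) *\<^sub>R A' h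
        - (inner (A w) (B' h) + inner (A' h) (B w)) *\<^sub>R B w - inner (A w) (B w) *\<^sub>R B' h)) (at w)"
    by (rule derivative_eq_intros A B refl)+ (simp add: algebra_simps inner_commute)
  show ?thesis
    unfolding coflux_def coflux_deriv_def
    by (rule has_derivative_eq_rhs[OF has_derivative_scaleR[OF ds dv]])
      (simp add: g_def s_def k_def algebra_simps)
qed

text \<open>\<open>A'\<close> cancels from both tangential components. What remains changes sign
  when \<open>A\<close> and \<open>B\<close> are exchanged with \<open>B'\<close> kept, so the two
  flux fields, which share the mixed derivative as \<open>B'\<close>, have opposite tangential
  contributions.\<close>

lemma inner_coflux_deriv:
  assumes D: "gram2 A B > 0"
  shows "sqrt (gram2 A B) * inner (coflux_deriv A B A' B') A
     = inner B B' * inner A A - inner A B * inner A B'"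
    and "sqrt (gram2 A B) * inner (coflux_deriv A B A' B') B
     = inner B B' * inner A B - inner A B' * inner B B"
    and "inner A n = 0 \<Longrightarrow> inner B n = 0 \<Longrightarrow> sqrt (gram2 A B) * inner (coflux_deriv A B A' B') n
     = inner B B * inner A' n - inner A B * inner B' n"
proof -
  define g where "g = gram2 A B"
  have g: "g > 0" "g = inner A A * inner B B - inner A B * inner A B"
    using D by (auto simp: g_def gram2_def power2_eq_square)
  have s: "sqrt g * (1 / sqrt g) = 1" "sqrt g * (k / (g * sqrt g)) = k / g" for k
    using g(1) by (auto simp: field_simps)
  have *: "sqrt g * inner (coflux_deriv A B A' B') x
     = inner ((2 * inner B B') *\<^sub>R A + inner B B *\<^sub>R A'
        - (inner A B' + inner A' B) *\<^sub>R B - inner A B *\<^sub>R B') x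
     - (inner A A' * inner B B + inner A A * inner B B' - inner A B * (inner A B' + inner A' B)) / g
        * inner (inner B B *\<^sub>R A - inner A B *\<^sub>R B) x" for x
    unfolding coflux_deriv_def g_def[symmetric] inner_diff_left[of _ "_ *\<^sub>R _"] inner_scaleR_left
      right_diff_distrib[of "sqrt g"] mult.assoc[of "sqrt g", symmetric] s by simp
  have kg: "k / g * g = k" for k using g(1) by simp
  \<comment> \<open>The vector inside \<open>coflux\<close> is orthogonal to \<open>B\<close> and
    has product \<open>g\<close> with \<open>A\<close>, so the term from differentiating the square
    root drops out of the \<open>B\<close> component and loses its denominator in the
    \<open>A\<close> component.\<close>
  have A: "inner (inner B B *\<^sub>R A - inner A B *\<^sub>R B) A = g"
    using g(2) by (simp add: inner_diff_left inner_commute[of B A] mult.commute)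
  have B: "inner (inner B B *\<^sub>R A - inner A B *\<^sub>R B) B = 0"
    by (simp add: inner_diff_left mult.commute)
  show "sqrt (gram2 A B) * inner (coflux_deriv A B A' B') A
     = inner B B' * inner A A - inner A B * inner A B'"
    unfolding g_def[symmetric] * A kg
    by (simp add: inner_diff_left inner_add_left inner_commute[of B A] inner_commute[of A' A]
        inner_commute[of B' A] algebra_simps)
  show "sqrt (gram2 A B) * inner (coflux_deriv A B A' B') B
     = inner B B' * inner A B - inner A B' * inner B B"
    unfolding g_def[symmetric] * B using g(1)
    by (simp add: inner_diff_left inner_add_left inner_commute[of B' B] algebra_simps)
  show "sqrt (gram2 A B) * inner (coflux_deriv A B A' B') n
     = inner B B * inner A' n - inner A B * inner B' n" if "inner A n = 0" "inner B n = 0"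
    unfolding g_def[symmetric] * using that by (simp add: inner_diff_left inner_add_left)
qed

section \<open>The drift Laplacian in local coordinates and the minimality equation\<close>

lemma bv_in_Basis [simp]: "bv i \<in> Basis"
  by (simp add: bv_def axis_in_Basis_iff)

lemma has_derivative_pd:
  assumes "f differentiable_on W" "open W" "w \<in> W"
  shows "(f has_derivative (\<lambda>h. pd h f w)) (at w)"
proof -
  have "f differentiable (at w)"
    using assms by (simp add: differentiable_on_eq_differentiable_at)
  then show ?thesis by (simp add: pd_def frechet_derivative_works[symmetric])
qed

lemma
  assumes "local_param X W p"
  shows local_param_open: "open W"
    and local_param_differentiable: "(X \<circ> p) differentiable_on W"
    and local_param_pd_differentiable: "b \<in> Basis \<Longrightarrow> pd b (X \<circ> p) differentiable_on W"
    and local_param_pd_pd_continuous: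
      "b \<in> Basis \<Longrightarrow> b' \<in> Basis \<Longrightarrow> continuous_on W (pd b' (pd b (X \<circ> p)))"
proof -
  have "Ck (Suc (Suc 0)) W (X \<circ> p)" using assms unfolding local_param_def smooth_on_def by blast
  then show "(X \<circ> p) differentiable_on W" "b \<in> Basis \<Longrightarrow> pd b (X \<circ> p) differentiable_on W"
     "b \<in> Basis \<Longrightarrow> b' \<in> Basis \<Longrightarrow> continuous_on W (pd b' (pd b (X \<circ> p)))"
    unfolding Ck.simps by blast+
  show "open W" using assms unfolding local_param_def by blast
qed

text \<open>Injectivity of the differential makes the coordinate tangent vectors linearly
  independent.\<close>

lemma gram2_local_param_pos:
  assumes lp: "local_param X W p" and w: "w \<in> W"
  shows "gram2 (pd (bv 1) (X \<circ> p) w) (pd (bv 2) (X \<circ> p) w) > 0"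
proof (rule gram2_pos)
  fix x y
  let ?D = "frechet_derivative (X \<circ> p) (at w)"
  assume 0: "x *\<^sub>R pd (bv 1) (X \<circ> p) w + y *\<^sub>R pd (bv 2) (X \<circ> p) w = 0"
  have "linear ?D"
    using has_derivative_linear[OF has_derivative_pd[OF local_param_differentiable[OF lp] local_param_open[OF lp] w]]
    by (simp add: pd_def)
  then interpret D: linear ?D .
  have "?D (x *\<^sub>R bv 1 + y *\<^sub>R bv 2) = ?D 0"
    using 0 by (simp add: D.add D.scale D.zero pd_def)
  moreover have "inj ?D" using lp w unfolding local_param_def by blast
  ultimately have "x *\<^sub>R bv 1 + y *\<^sub>R bv 2 = 0" by (blast dest: injD)
  then show "x = 0 \<and> y = 0"
    by (simp add: vec_eq_iff forall_2 bv_def axis_def)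
qed

lemma det_metric_loc:
  "det (metric_loc X p w) = gram2 (pd (bv 1) (X \<circ> p) w) (pd (bv 2) (X \<circ> p) w)"
  by (simp add: det_2 metric_loc_def gram2_def power2_eq_square inner_commute)

lemma metric_inv_loc_eq:
  assumes lp: "local_param X W p" and w: "w \<in> W"
  defines "A \<equiv> pd (bv 1) (X \<circ> p) w" and "B \<equiv> pd (bv 2) (X \<circ> p) w"
  shows "metric_inv_loc X p w 1 1 = inner B B / gram2 A B"
    and "metric_inv_loc X p w 1 2 = - inner A B / gram2 A B"
    and "metric_inv_loc X p w 2 1 = - inner A B / gram2 A B"
    and "metric_inv_loc X p w 2 2 = inner A A / gram2 A B"
proof -
  have d: "det (metric_loc X p w) \<noteq> 0"
    using gram2_local_param_pos[OF lp w] by (simp add: det_metric_loc)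
  show "metric_inv_loc X p w 1 1 = inner B B / gram2 A B"
    "metric_inv_loc X p w 1 2 = - inner A B / gram2 A B"
    "metric_inv_loc X p w 2 1 = - inner A B / gram2 A B"
    "metric_inv_loc X p w 2 2 = inner A A / gram2 A B"
    unfolding metric_inv_loc_def matrix_inv_2[OF d] det_metric_loc A_def B_def
    by (simp_all add: metric_loc_def inner_commute)
qed

lemma pd_compose_gradient:
  fixes F :: "'b::euclidean_space \<Rightarrow> real"
  assumes F: "\<And>x. (F has_derivative (\<lambda>h. inner (U x) h)) (at x)"
    and Y: "Y differentiable_on W" "open W" "w \<in> W"
  shows "pd b (F \<circ> Y) w = inner (U (Y w)) (pd b Y w)"
  by (rule pd_eqI) (rule diff_chain_at[OF has_derivative_pd[OF Y] F, unfolded comp_def[of "inner _"]])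

text \<open>The product rule separates three contributions: the terms in \<open>U'\<close> give the
  tangential trace of the Hessian of \<open>F\<close>, those in \<open>coflux_deriv\<close> the
  divergence of the coordinate fields, and the last one the drift, a tangential product of
  \<open>e3\<close> with the gradient \<open>U\<close>.\<close>

lemma lap_phi_loc_compose:
  fixes F :: "real^3 \<Rightarrow> real"
  assumes lp: "local_param X W p" and w: "w \<in> W"
    and F: "\<And>x. (F has_derivative (\<lambda>h. inner (U x) h)) (at x)"
    and U: "(U has_derivative U') (at (X (p w)))"
    and \<phi>: "(\<phi> has_real_derivative \<phi>') (at (height X (p w)))"
  defines "A \<equiv> pd (bv 1) (X \<circ> p) w" and "B \<equiv> pd (bv 2) (X \<circ> p) w"
  shows "lap_phi_loc X \<phi> (F \<circ> X) p w =
    (1 / sqrt (gram2 A B)) *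
      (inner (U' A) (coflux A B) + inner (U' B) (coflux B A)
       + inner (U (X (p w)))
         (coflux_deriv A B (pd (bv 1) (pd (bv 1) (X \<circ> p)) w) (pd (bv 1) (pd (bv 2) (X \<circ> p)) w)
        + coflux_deriv B A (pd (bv 2) (pd (bv 2) (X \<circ> p)) w) (pd (bv 2) (pd (bv 1) (X \<circ> p)) w)))
    + \<phi>' * ((inner B B * (inner e3 A * inner (U (X (p w))) A)
         - inner A B * (inner e3 A * inner (U (X (p w))) B + inner e3 B * inner (U (X (p w))) A)
         + inner A A * (inner e3 B * inner (U (X (p w))) B)) / gram2 A B)"
proof -
  let ?Y = "X \<circ> p" and ?Y1 = "pd (bv 1) (X \<circ> p)" and ?Y2 = "pd (bv 2) (X \<circ> p)"
  note W = local_param_open[OF lp]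
  note dY = has_derivative_pd[OF local_param_differentiable[OF lp] W]
  note dYi = has_derivative_pd[OF local_param_pd_differentiable[OF lp bv_in_Basis] W]
  have pos: "gram2 (?Y1 z) (?Y2 z) > 0" if "z \<in> W" for z
    using gram2_local_param_pos[OF lp that] .
  have v: "pd b (F \<circ> ?Y) z = inner (U (?Y z)) (pd b ?Y z)" if "z \<in> W" for b z
    using pd_compose_gradient[OF F local_param_differentiable[OF lp] W that] .
  have dU: "((\<lambda>z. U (?Y z)) has_derivative (\<lambda>h. U' (pd h ?Y w))) (at w)"
    using diff_chain_at[OF dY[OF w], of U U'] U by (simp add: comp_def)
  \<comment> \<open>The flux under the divergence. On \<open>W\<close> it is the product of
    \<open>U\<close> with a \<open>coflux\<close> field, because the area density times the
    reciprocal Gram determinant is the reciprocal square root.\<close>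
  let ?fl = "\<lambda>i z. sqrt (det (metric_loc X p z)) * (\<Sum>j\<in>UNIV. metric_inv_loc X p z i j * pd (bv j) (F \<circ> ?Y) z)"
  have sq: "sqrt x * (k / x) = k / sqrt x" if "x > 0" for x k :: real
    using that by (simp add: field_simps)
  have fl1: "?fl 1 z = inner (U (?Y z)) (coflux (?Y1 z) (?Y2 z))" if "z \<in> W" for z
    unfolding sum_2 det_metric_loc metric_inv_loc_eq[OF lp that] v[OF that] distrib_left
      mult.assoc[of "sqrt _", symmetric] sq[OF pos[OF that]] coflux_def
    by (simp add: inner_diff_right diff_divide_distrib)
  have fl2: "?fl 2 z = inner (U (?Y z)) (coflux (?Y2 z) (?Y1 z))" if "z \<in> W" for z
    unfolding sum_2 det_metric_loc metric_inv_loc_eq[OF lp that] v[OF that] distrib_left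
      mult.assoc[of "sqrt _", symmetric] sq[OF pos[OF that]] coflux_def gram2_commute[of "?Y2 z"]
    by (simp add: inner_diff_right diff_divide_distrib inner_commute[of "?Y2 z" "?Y1 z"])
  have posw: "gram2 A B > 0" "gram2 B A > 0" using pos[OF w] by (simp_all add: A_def B_def gram2_commute)
  have pd1: "pd (bv 1) (?fl 1) w = inner (U' A) (coflux A B) + inner (U (?Y w))
      (coflux_deriv A B (pd (bv 1) ?Y1 w) (pd (bv 1) ?Y2 w))"
  proof -
    have "pd (bv 1) (?fl 1) w = pd (bv 1) (\<lambda>z. inner (U (?Y z)) (coflux (?Y1 z) (?Y2 z))) w"
      by (rule pd_cong_open[OF W w fl1])
    also have "\<dots> = inner (U (?Y w)) (coflux_deriv A B (pd (bv 1) ?Y1 w) (pd (bv 1) ?Y2 w))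
         + inner (U' A) (coflux A B)"
      unfolding A_def B_def
      by (rule pd_eqI[OF has_derivative_inner[OF dU has_derivative_coflux[OF dYi[OF w] dYi[OF w]]]])
        (rule pos[OF w])
    finally show ?thesis by simp
  qed
  have pd2: "pd (bv 2) (?fl 2) w = inner (U' B) (coflux B A) + inner (U (?Y w))
      (coflux_deriv B A (pd (bv 2) ?Y2 w) (pd (bv 2) ?Y1 w))"
  proof -
    have "pd (bv 2) (?fl 2) w = pd (bv 2) (\<lambda>z. inner (U (?Y z)) (coflux (?Y2 z) (?Y1 z))) w"
      by (rule pd_cong_open[OF W w fl2])
    also have "\<dots> = inner (U (?Y w)) (coflux_deriv B A (pd (bv 2) ?Y2 w) (pd (bv 2) ?Y1 w))
         + inner (U' B) (coflux B A)"
      unfolding A_def B_def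
      by (rule pd_eqI[OF has_derivative_inner[OF dU has_derivative_coflux[OF dYi[OF w] dYi[OF w]]]])
        (use pos[OF w] in \<open>simp add: gram2_commute\<close>)
    finally show ?thesis by simp
  qed
  have dh: "((\<lambda>z. height X (p z)) has_derivative (\<lambda>h. inner (pd h ?Y w) e3)) (at w)"
    using has_derivative_inner_left[OF dY[OF w], of e3] by (simp add: height_def comp_def)
  have f: "pd b (\<lambda>z. \<phi> (height X (p z))) w = \<phi>' * inner e3 (pd b ?Y w)" for b
    by (rule pd_eqI[OF DERIV_compose_FDERIV[OF \<phi> dh], THEN trans]) (simp add: inner_commute)
  have "lap_phi_loc X \<phi> (F \<circ> X) p w = 1 / sqrt (gram2 A B) * (pd (bv 1) (?fl 1) w + pd (bv 2) (?fl 2) w)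
     + (\<Sum>i\<in>UNIV. \<Sum>j\<in>UNIV. metric_inv_loc X p w i j * (\<phi>' * inner e3 (pd (bv i) ?Y w))
          * inner (U (?Y w)) (pd (bv j) ?Y w))"
    unfolding lap_phi_loc_def Let_def comp_assoc f v[OF w] det_metric_loc[of X p w] A_def B_def
      sum_2[of "\<lambda>i. pd (bv i) (?fl i) w", symmetric] by simp
  also have "(\<Sum>i\<in>UNIV. \<Sum>j\<in>UNIV. metric_inv_loc X p w i j * (\<phi>' * inner e3 (pd (bv i) ?Y w))
          * inner (U (?Y w)) (pd (bv j) ?Y w))
     = \<phi>' * ((inner B B * (inner e3 A * inner (U (X (p w))) A)
         - inner A B * (inner e3 A * inner (U (X (p w))) B + inner e3 B * inner (U (X (p w))) A)
         + inner A A * (inner e3 B * inner (U (X (p w))) B)) / gram2 A B)"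
    unfolding sum_2 metric_inv_loc_eq[OF lp w] A_def[symmetric] B_def[symmetric]
    using posw by (simp add: field_simps)
  finally show ?thesis unfolding pd1 pd2 inner_add_right comp_apply[of X p w] by (simp only: add_ac)
qed

text \<open>Both sides of the vector equation in \<open>phi_minimal\<close> are multiples of the
  nonzero normal, so their scalar coefficients agree; the inverse metric is then written
  out.\<close>

lemma mean_curvature_equation:
  assumes lp: "local_param X W p" and w: "w \<in> W"
    and N: "unit_normal X N" and M: "phi_minimal X N \<phi>"
  defines "A \<equiv> pd (bv 1) (X \<circ> p) w" and "B \<equiv> pd (bv 2) (X \<circ> p) w" and "n \<equiv> N (p w)"
  shows "(inner B B * inner (pd (bv 1) (pd (bv 1) (X \<circ> p)) w) n
      - inner A B * inner (pd (bv 1) (pd (bv 2) (X \<circ> p)) w) n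
      - inner A B * inner (pd (bv 2) (pd (bv 1) (X \<circ> p)) w) n
      + inner A A * inner (pd (bv 2) (pd (bv 2) (X \<circ> p)) w) n) / gram2 A B
    = deriv \<phi> (height X (p w)) * inner e3 n"
proof -
  have "norm n = 1" using N unfolding unit_normal_def n_def by blast
  then have n: "n \<noteq> 0" by auto
  have "mean_curv_vec_loc X N p w = (deriv \<phi> (height X (p w)) * angle_fun N (p w)) *\<^sub>R n"
    using M lp w unfolding phi_minimal_def n_def by blast
  then have "(\<Sum>i\<in>UNIV. \<Sum>j\<in>UNIV. metric_inv_loc X p w i j * inner (pd (bv i) (pd (bv j) (X \<circ> p)) w) n)
    = deriv \<phi> (height X (p w)) * inner e3 n"
    using n unfolding mean_curv_vec_loc_def n_def[symmetric]
    by (simp add: angle_fun_def n_def inner_commute[of e3])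
  moreover have "gram2 A B > 0" using gram2_local_param_pos[OF lp w] by (simp add: A_def B_def)
  ultimately show ?thesis
    unfolding sum_2 metric_inv_loc_eq[OF lp w] A_def[symmetric] B_def[symmetric]
    by (simp add: add_divide_distrib diff_divide_distrib)
qed

text \<open>The divergence \<open>T\<close> of the frame fields is normal to the surface (this uses equality of the mixed
  derivatives) and its normal component is the mean curvature. Hence the normal terms of the
  Laplacian and of the drift add up to the full product with \<open>e3\<close>.\<close>
lemma lap_phi_loc_phi_minimal:
  fixes F :: "real^3 \<Rightarrow> real"
  assumes lp: "local_param X W p" and w: "w \<in> W"
    and N: "unit_normal X N" and M: "phi_minimal X N \<phi>"
    and F: "\<And>x. (F has_derivative (\<lambda>h. inner (U x) h)) (at x)"
    and U: "(U has_derivative U') (at (X (p w)))"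
    and \<phi>: "\<phi> differentiable (at (height X (p w)))"
  defines "A \<equiv> pd (bv 1) (X \<circ> p) w" and "B \<equiv> pd (bv 2) (X \<circ> p) w"
  shows "lap_phi_loc X \<phi> (F \<circ> X) p w =
    deriv \<phi> (height X (p w)) * inner e3 (U (X (p w)))
    + (inner B B * inner (U' A) A - inner A B * (inner (U' A) B + inner (U' B) A)
       + inner A A * inner (U' B) B) / gram2 A B"
proof -
  define n where "n = N (p w)"
  define V where "V = U (X (p w))"
  define A1 where "A1 = pd (bv 1) (pd (bv 1) (X \<circ> p)) w"
  define B1 where "B1 = pd (bv 1) (pd (bv 2) (X \<circ> p)) w"
  define B2 where "B2 = pd (bv 2) (pd (bv 2) (X \<circ> p)) w"
  define d where "d = deriv \<phi> (height X (p w))"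
  have sym: "pd (bv 2) (pd (bv 1) (X \<circ> p)) w = B1"
    unfolding B1_def
    by (rule pd_pd_commute[OF local_param_open[OF lp] w local_param_differentiable[OF lp]])
      (rule local_param_pd_differentiable[OF lp bv_in_Basis])+
  define g where "g = gram2 A B"
  have D: "gram2 A B > 0" using gram2_local_param_pos[OF lp w] by (simp add: A_def B_def)
  then have D': "gram2 B A > 0" by (simp add: gram2_commute)
  have g: "g > 0" using D by (simp add: g_def)
  define s where "s = sqrt g"
  have s: "s > 0" "s * s = g" using g by (auto simp: s_def)
  have n: "norm n = 1" "inner n A = 0" "inner n B = 0"
    using N lp w unfolding unit_normal_def n_def A_def B_def by blast+
  note frame = inner_frame_decomposition[OF D n]
  define T where "T = coflux_deriv A B A1 B1 + coflux_deriv B A B2 B1"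
  note ic = inner_coflux_deriv[OF D, where A' = A1 and B' = B1]
    inner_coflux_deriv[OF D', where A' = B2 and B' = B1]
  have sT: "s * inner T x = sqrt (gram2 A B) * inner (coflux_deriv A B A1 B1) x
      + sqrt (gram2 B A) * inner (coflux_deriv B A B2 B1) x" for x
    by (simp add: T_def s_def g_def gram2_commute[of B A] inner_add_left distrib_left)
  have "s * inner T A = 0" unfolding sT ic by (simp add: inner_commute[of B A])
  then have TA: "inner T A = 0" using s by simp
  have "s * inner T B = 0" unfolding sT ic by (simp add: inner_commute[of B A])
  then have TB: "inner T B = 0" using s by simp
  have An: "inner A n = 0" "inner B n = 0" using n by (simp_all add: inner_commute)
  have "s * inner T n = inner B B * inner A1 n - inner A B * inner B1 n - inner A B * inner B1 n
      + inner A A * inner B2 n"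
    unfolding sT ic(3)[OF An] ic(6)[OF An(2,1)] by (simp add: inner_commute[of B A])
  also have "\<dots> = g * (d * inner e3 n)"
    using mean_curvature_equation[OF lp w N M] g
    unfolding A_def[symmetric] B_def[symmetric] n_def[symmetric] sym A1_def[symmetric]
      B1_def[symmetric] B2_def[symmetric] d_def[symmetric] g_def[symmetric]
    by (simp add: field_simps)
  also have "\<dots> = s * (s * (d * inner e3 n))" unfolding s(2)[symmetric] by (rule mult.assoc)
  finally have Tn: "inner T n = s * (d * inner e3 n)" using s(1) by simp
  \<comment> \<open>Since \<open>T\<close> has no tangential components, only the normal term of the
    frame decomposition survives.\<close>
  have VT: "inner V T = s * (d * inner e3 n * inner V n)"
    using frame[of V T] TA TB Tn by simp
  have co: "1 / s * (inner (U' A) (coflux A B) + inner (U' B) (coflux B A))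
     = (inner B B * inner (U' A) A - inner A B * (inner (U' A) B + inner (U' B) A)
       + inner A A * inner (U' B) B) / g"
    unfolding coflux_def gram2_commute[of B A] g_def[symmetric] s_def[symmetric] using s(1)
    unfolding s(2)[symmetric] by (simp add: inner_diff_right inner_commute[of B A] field_simps)
  have \<phi>': "(\<phi> has_real_derivative d) (at (height X (p w)))"
    using \<phi> unfolding d_def by (simp add: DERIV_deriv_iff_real_differentiable)
  \<comment> \<open>The frame decomposition rewrites the drift as \<open>d\<close> times the full
    product of \<open>e3\<close> and \<open>V\<close> minus its normal part. The term
    \<open>inner V T\<close> restores exactly that normal part.\<close>
  have "lap_phi_loc X \<phi> (F \<circ> X) p w =
     1 / s * (inner (U' A) (coflux A B) + inner (U' B) (coflux B A) + inner V T)
     + d * (inner e3 V - inner e3 n * inner V n)"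
    unfolding lap_phi_loc_compose[OF lp w F U \<phi>'] A_def[symmetric] B_def[symmetric] sym
      A1_def[symmetric] B1_def[symmetric] B2_def[symmetric] V_def[symmetric] T_def[symmetric]
      g_def[symmetric] s_def[symmetric]
    using frame[of e3 V] unfolding g_def by simp
  also have "\<dots> = d * inner e3 V + 1 / s * (inner (U' A) (coflux A B) + inner (U' B) (coflux B A))"
    using s(1) unfolding VT by (simp add: field_simps)
  finally show ?thesis unfolding co d_def V_def g_def by simp
qed

text \<open>The second derivative evaluates \<open>U'\<close> at a base point and a direction that
  both vary with the coordinate, which is why continuity is required jointly in the two
  arguments.\<close>

lemma C2_surf_compose:
  fixes F :: "real^3 \<Rightarrow> real"
  assumes F: "\<And>x. (F has_derivative (\<lambda>h. inner (U x) h)) (at x)"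
    and U: "\<And>x. (U has_derivative U' x) (at x)"
    and U': "continuous_on UNIV (\<lambda>(x, h). U' x h)"
  shows "C2_surf X (F \<circ> X)"
  unfolding C2_surf_def
proof (intro allI impI)
  fix W p
  assume lp: "local_param X W p"
  let ?Y = "X \<circ> p"
  note W = local_param_open[OF lp]
  note Y = local_param_differentiable[OF lp] local_param_pd_differentiable[OF lp]
  note dY = has_derivative_pd[OF Y(1) W]
  note dYi = has_derivative_pd[OF Y(2) W]
  have v: "pd b (F \<circ> ?Y) z = inner (U (?Y z)) (pd b ?Y z)" if "z \<in> W" for b z
    using pd_compose_gradient[OF F Y(1) W that] .
  have dv: "(pd b (F \<circ> ?Y) has_derivative
      (\<lambda>h. inner (U (?Y z)) (pd h (pd b ?Y) z) + inner (U' (?Y z) (pd h ?Y z)) (pd b ?Y z))) (at z)"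
    if b: "b \<in> Basis" and z: "z \<in> W" for b z
  proof -
    have "((\<lambda>z. U (?Y z)) has_derivative (\<lambda>h. U' (?Y z) (pd h ?Y z))) (at z)"
      using diff_chain_at[OF dY[OF z] U] by (simp add: comp_def)
    from has_derivative_inner[OF this dYi[OF b z]] show ?thesis
      by (rule has_derivative_transform_within_open[OF _ W z]) (simp add: v)
  qed
  have "(F \<circ> ?Y) differentiable_on W"
    using diff_chain_at[OF dY F] differentiable_at_imp_differentiable_on differentiable_def by blast
  moreover have "pd b (F \<circ> ?Y) differentiable_on W" if "b \<in> Basis" for b
    using dv[OF that] differentiable_at_imp_differentiable_on differentiable_def by blast
  moreover have "continuous_on W (pd c (pd b (F \<circ> ?Y)))" if b: "b \<in> Basis" and c: "c \<in> Basis" for b c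
  proof -
    have cY: "continuous_on W ?Y" "continuous_on W (pd b ?Y)" "continuous_on W (pd c ?Y)"
      using Y(1) Y(2)[OF b] Y(2)[OF c] by (simp_all only: differentiable_imp_continuous_on)
    have "continuous_on UNIV U"
      using U has_derivative_continuous continuous_at_imp_continuous_on by blast
    then have "continuous_on W (\<lambda>z. U (?Y z))"
      by (rule continuous_on_compose2[OF _ cY(1) subset_UNIV])
    moreover have "continuous_on W (\<lambda>z. U' (?Y z) (pd c ?Y z))"
      using continuous_on_compose2[OF U' continuous_on_Pair[OF cY(1,3)] subset_UNIV]
      unfolding prod.case .
    ultimately have "continuous_on W (\<lambda>z. inner (U (?Y z)) (pd c (pd b ?Y) z)
        + inner (U' (?Y z) (pd c ?Y z)) (pd b ?Y z))"
      by (rule continuous_on_add[OF continuous_on_inner[OF _ local_param_pd_pd_continuous[OF lp b c]]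
            continuous_on_inner[OF _ cY(2)]])
    then show ?thesis
      by (rule continuous_on_eq) (simp only: pd_eqI[OF dv[OF b]])
  qed
  ultimately show "Ck 2 W (F \<circ> X \<circ> p)"
    by (simp add: numeral_2_eq_2 comp_assoc)
qed

section \<open>The barrier function of the cone\<close>

text \<open>A smoothing of the function \<open>inner x e3 - a * norm x\<close> that defines the
  cone: replacing the norm removes the singularity at the origin, through which the surface may
  pass.\<close>

definition cone_barrier :: "real \<Rightarrow> real^3 \<Rightarrow> real" where
  "cone_barrier a x = inner x e3 - a * sqrt (1 + inner x x)"

definition cone_barrier_grad :: "real \<Rightarrow> real^3 \<Rightarrow> real^3" where
  "cone_barrier_grad a x = e3 - (a / sqrt (1 + inner x x)) *\<^sub>R x"

definition cone_barrier_hess :: "real \<Rightarrow> real^3 \<Rightarrow> real^3 \<Rightarrow> real^3" where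
  "cone_barrier_hess a x h = (a * inner x h / sqrt (1 + inner x x) ^ 3) *\<^sub>R x - (a / sqrt (1 + inner x x)) *\<^sub>R h"

lemma one_plus_inner_pos [simp]: "1 + inner x x > 0"
  by (simp add: add_pos_nonneg)

lemma has_derivative_sqrt_one_plus_inner:
  "((\<lambda>x::'a::real_inner. sqrt (1 + inner x x)) has_derivative (\<lambda>h. inner x h / sqrt (1 + inner x x))) (at x)"
proof -
  have "((\<lambda>x::'a. 1 + inner x x) has_derivative (\<lambda>h. 2 * inner x h)) (at x)"
    by (auto intro!: derivative_eq_intros simp: inner_commute)
  from has_derivative_real_sqrt[OF one_plus_inner_pos this] show ?thesis
    by (rule has_derivative_eq_rhs) (simp add: fun_eq_iff field_simps)
qed

lemma has_derivative_cone_barrier: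
  "(cone_barrier a has_derivative (\<lambda>h. inner (cone_barrier_grad a x) h)) (at x)"
  unfolding cone_barrier_def[abs_def] cone_barrier_grad_def
  by (rule has_derivative_eq_rhs, rule has_derivative_diff, rule has_derivative_inner_left,
      rule has_derivative_ident, rule has_derivative_mult_right,
      rule has_derivative_sqrt_one_plus_inner)
    (simp add: fun_eq_iff inner_diff_left inner_commute[of _ e3])

lemma has_derivative_cone_barrier_grad:
  "(cone_barrier_grad a has_derivative cone_barrier_hess a x) (at x)"
proof -
  define s where "s = sqrt (1 + inner x x)"
  have s: "s > 0" by (simp add: s_def)
  have "((\<lambda>x. a / sqrt (1 + inner x x)) has_derivative (\<lambda>h. - (a * inner x h / s ^ 3))) (at x)"
    by (rule has_derivative_eq_rhs[OF has_derivative_divide[OF has_derivative_const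
          has_derivative_sqrt_one_plus_inner]])
      (use s in \<open>simp_all add: s_def[symmetric] fun_eq_iff field_simps power3_eq_cube\<close>)
  from has_derivative_diff[OF has_derivative_const[of e3] has_derivative_scaleR[OF this has_derivative_ident]]
  show ?thesis
    unfolding cone_barrier_grad_def[abs_def] cone_barrier_hess_def[abs_def] s_def[symmetric]
    by (rule has_derivative_eq_rhs) (simp add: fun_eq_iff s_def)
qed

lemma continuous_cone_barrier_hess: "continuous_on UNIV (\<lambda>(x, h). cone_barrier_hess a x h)"
proof -
  have "sqrt (1 + inner x x) \<noteq> 0" for x :: "real^3"
    using less_imp_neq[OF one_plus_inner_pos[of x]] by simp
  then show ?thesis
    unfolding cone_barrier_hess_def case_prod_beta by (intro continuous_intros) auto
qed

lemma cone_set_height_le: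
  assumes "x \<in> cone_set a" "a > 0"
  shows "inner x e3 \<le> a * sqrt (1 + inner x x)"
proof -
  have "inner x e3 \<le> a * norm x"
  \<comment> \<open>The origin belongs to \<open>cone_set a\<close>, as normalizing it gives the
    zero vector; both sides vanish there.\<close>
  proof (cases "x = 0")
    case False
    have "inner x e3 / norm x \<le> a" using assms(1) by (simp add: cone_set_def divide_inverse mult.commute)
    then show ?thesis using False by (simp add: field_simps)
  qed simp
  also have "\<dots> \<le> a * sqrt (1 + inner x x)"
    using assms(2) by (intro mult_left_mono) (simp_all add: norm_eq_sqrt_inner)
  finally show ?thesis .
qed

text \<open>By the frame decomposition, the contribution of the rank-one part of the Hessian is a
  nonnegative multiple of the squared norm of the tangential part of \<open>x\<close>, so it can be dropped.\<close>
lemma cone_barrier_hess_trace: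
  fixes A B n x :: "real^3"
  assumes D: "gram2 A B > 0" and n: "norm n = 1" "inner n A = 0" "inner n B = 0" and a: "a > 0"
  defines "H \<equiv> cone_barrier_hess a x"
  shows "(inner B B * inner (H A) A - inner A B * (inner (H A) B + inner (H B) A)
       + inner A A * inner (H B) B) / gram2 A B \<ge> - 2 * a"
proof -
  define s where "s = sqrt (1 + inner x x)"
  have s: "s \<ge> 1" by (simp add: s_def)
  have g: "inner A A * inner B B - inner A B * inner A B = gram2 A B"
    by (simp add: gram2_def power2_eq_square)
  let ?q = "inner B B * (inner x A * inner x A) - inner A B * (inner x A * inner x B + inner x B * inner x A)
       + inner A A * (inner x B * inner x B)"
  have "inner x x = inner x n * inner x n + ?q / gram2 A B"
    by (rule inner_frame_decomposition[OF D n])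
  moreover have "inner x n * inner x n \<le> inner x x"
    using Cauchy_Schwarz_ineq[of x n] n(1) by (simp add: power2_eq_square dot_square_norm)
  ultimately have q: "?q / gram2 A B \<ge> 0" by simp
  \<comment> \<open>The rank-one part of the Hessian contributes \<open>?q\<close>. The multiple of
    the identity contributes twice the Gram determinant, since the tangent plane has dimension
    two.\<close>
  have "inner B B * inner (H A) A - inner A B * (inner (H A) B + inner (H B) A) + inner A A * inner (H B) B
     = a / s ^ 3 * ?q - 2 * a / s * (inner A A * inner B B - inner A B * inner A B)"
    unfolding H_def cone_barrier_hess_def s_def[symmetric] inner_diff_left inner_scaleR_left inner_commute[of B A]
    by (simp add: algebra_simps diff_divide_distrib add_divide_distrib)
  then have "(inner B B * inner (H A) A - inner A B * (inner (H A) B + inner (H B) A)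
       + inner A A * inner (H B) B) / gram2 A B = a / s ^ 3 * (?q / gram2 A B) - 2 * a / s"
    unfolding g using D by (simp add: diff_divide_distrib)
  moreover have "a / s ^ 3 * (?q / gram2 A B) \<ge> 0"
    using q a s by (intro mult_nonneg_nonneg) auto
  moreover have "2 * a / s \<le> 2 * a" using a s by (simp add: divide_le_eq mult_le_cancel_left1)
  ultimately show ?thesis by simp
qed

section \<open>The uniform lower bound and the contradiction\<close>

theorem theoremE:
  fixes X :: "'m::t2_space \<Rightarrow> real^3" and N :: "'m \<Rightarrow> real^3"
    and \<phi> :: "real \<Rightarrow> real" and a \<xi> :: real
  assumes "0 < a" and "a < 1"
    and "smooth_on UNIV \<phi>"
    and "immersed_surface X"
    and "unit_normal X N"
    and "phi_minimal X N \<phi>"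
    and "phi_stoch_complete X \<phi>"
    and "\<forall>q. X q \<in> cone_set a"
    and "\<xi> > 2 * a / (1 - a^2)"
    and "\<forall>q. deriv \<phi> (height X q) > \<xi>"
  shows False
proof -
  \<comment> \<open>The drift contributes at least the first term and the Hessian at least
    \<open>- 2 * a\<close>; positivity of the sum is the hypothesis on \<xi>, multiplied by
    \<open>1 - a^2\<close>.\<close>
  define \<delta> where "\<delta> = \<xi> * (1 - a^2) - 2 * a"
  have a2: "1 - a^2 > 0" using assms(1,2) by (simp add: power_less_one_iff abs_square_less_1)
  have \<delta>: "\<delta> > 0" using assms(9) a2 by (simp add: \<delta>_def field_simps)
  have "2 * a / (1 - a^2) > 0" using assms(1) a2 by simp
  then have \<xi>: "\<xi> > 0" using assms(9) by linarith
  have below: "inner (X q) e3 \<le> a * sqrt (1 + inner (X q) (X q))" for q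
    using cone_set_height_le assms(1,8) by blast
  \<comment> \<open>The bound is established in every parametrization, because stochastic
    completeness provides an unspecified one around each point.\<close>
  have lap: "lap_phi_loc X \<phi> (cone_barrier a \<circ> X) p w \<ge> \<delta>" if lp: "local_param X W p" and w: "w \<in> W" for W p w
  proof -
    let ?A = "pd (bv 1) (X \<circ> p) w" and ?B = "pd (bv 2) (X \<circ> p) w"
    let ?x = "X (p w)"
    have "Ck (Suc 0) UNIV \<phi>" using assms(3) unfolding smooth_on_def by blast
    then have \<phi>: "\<phi> differentiable (at (height X (p w)))"
      by (simp add: differentiable_on_def)
    have n: "norm (N (p w)) = 1" "inner (N (p w)) ?A = 0" "inner (N (p w)) ?B = 0"
      using assms(5) lp w unfolding unit_normal_def by blast+
    define s where "s = sqrt (1 + inner ?x ?x)"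
    have s: "s > 0" by (simp add: s_def)
    \<comment> \<open>The vertical component of the gradient is
      \<open>1 - a * inner ?x e3 / s\<close>, so the height bound scaled by \<open>a / s\<close>
      keeps it at least \<open>1 - a^2\<close>.\<close>
    have "a * inner ?x e3 \<le> a * (a * s)"
      using below[of "p w"] assms(1) unfolding s_def by (intro mult_left_mono) auto
    then have "a * inner ?x e3 / s \<le> a^2"
      using s by (simp add: divide_le_eq power2_eq_square)
    moreover have "inner e3 e3 = 1" by (simp add: e3_def inner_axis_axis)
    ultimately have e: "inner e3 (cone_barrier_grad a ?x) \<ge> 1 - a^2"
      unfolding cone_barrier_grad_def s_def[symmetric] by (simp add: inner_diff_right inner_commute[of e3 ?x])
    have "\<xi> * (1 - a^2) \<le> deriv \<phi> (height X (p w)) * inner e3 (cone_barrier_grad a ?x)"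
      using e a2 \<xi> assms(10)[rule_format, of "p w"] by (intro mult_mono) auto
    then show ?thesis
      unfolding lap_phi_loc_phi_minimal[OF lp w assms(5,6) has_derivative_cone_barrier
          has_derivative_cone_barrier_grad \<phi>]
      using cone_barrier_hess_trace[OF gram2_local_param_pos[OF lp w] n assms(1), of ?x]
      by (simp add: \<delta>_def)
  qed
  have C2: "C2_surf X (cone_barrier a \<circ> X)"
    by (rule C2_surf_compose[OF has_derivative_cone_barrier has_derivative_cone_barrier_grad
          continuous_cone_barrier_hess])
  have bdd: "bdd_above (range (cone_barrier a \<circ> X))"
    using below by (intro bdd_aboveI[of _ 0]) (auto simp: cone_barrier_def)
  obtain q where q: "\<forall>n::nat. n > 0 \<longrightarrow>
        (cone_barrier a \<circ> X) (q n) > (SUP x. (cone_barrier a \<circ> X) x) - 1 / real n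
        \<and> (\<exists>W p w. local_param X W p \<and> w \<in> W \<and> p w = q n
               \<and> lap_phi_loc X \<phi> (cone_barrier a \<circ> X) p w < 1 / real n)"
    using assms(7)[unfolded phi_stoch_complete_def, rule_format, OF conjI[OF C2 bdd]] by (rule exE)
  \<comment> \<open>At the point of index \<open>n\<close> the drift Laplacian would be below
    \<open>1 / real n\<close>, hence below \<delta>.\<close>
  obtain n :: nat where n: "n > 0" "inverse (real n) < \<delta>"
    using ex_inverse_of_nat_less[OF \<delta>] by auto
  obtain W p w where "local_param X W p" "w \<in> W"
    and "lap_phi_loc X \<phi> (cone_barrier a \<circ> X) p w < 1 / real n"
    using q[rule_format, OF n(1), THEN conjunct2] by (elim exE conjE)
  then show False
    using lap[of W p w] n(2) by (simp add: inverse_eq_divide)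
qed

end
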